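(* The set $\mathcal{PO}^\alpha_2$ is not always fully obtained by minimizing $H_\lambda$ for $\lambda\in[0,1]$: there exist an instance of the network design setting (a network $\mathcal{N}=(N,E)$ containing cycles, costs $b,c$, arc lengths $d$, O/D pairs $W$, demands $g$, private utilities $u$, and $\alpha\in[0,1]$) and a subgraph $\mathcal{S}_1\in\mathcal{PO}^\alpha_2$ such that for no $\lambda\in[0,1]$ is $\mathcal{S}_1$ a $\lambda$-cent-dian, i.e. for no $\lambda\in[0,1]$ does $\mathcal{S}_1$ minimize $H_\lambda(\mathcal{S})=\lambda F_c(\mathcal{S})+(1-\lambda)F_m(\mathcal{S})$ over $\mathcal{S}\in\mathcal{N}^\alpha$.
   Context: Setting. $\mathcal{N}=(N,E)$ is a finite undirected graph with node costs $b_i\ge 0$ ($i\in N$) and edge costs $c_e\ge 0$ ($e\in E$). Each edge $\{i,j\}\in E$ gives two arcs $(i,j)$ and $(j,i)$; each arc $a$ has a length $d_a\ge 0$. $W\subset N\times N$ is a finite nonempty set of origin/destination pairs $w=(w^s,w^t)$ with $w^s\ne w^t$; each $w\in W$ has a demand $g^w>0$ and a private utility $u^w>0$. Put $G=\sum_{w\in W}g^w$. Feasible subgraphs. For $\alpha\in[0,1]$, $\mathcal{N}^\alpha$ is the set of all subgraphs $\mathcal{S}=(N_{\mathcal S},E_{\mathcal S})$ of $\mathcal N$ (the empty subgraph is allowed) with $\sum_{i\in N_{\mathcal S}}b_i+\sum_{e\in E_{\mathcal S}}c_e\le \alpha\big(\sum_{i\in N}b_i+\sum_{e\in E}c_e\big)$.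 Lengths. For a subgraph $\mathcal S$ and $w\in W$, $d_{\mathcal S}(w)$ is the length of a shortest path from $w^s$ to $w^t$ using arcs arising from edges of $\mathcal S$, with $d_{\mathcal S}(w)=+\infty$ if no such path exists in $\mathcal{S}$; and $\ell_{\mathcal S}(w)=\min\{d_{\mathcal S}(w),u^w\}$. Objectives. $F_m(\mathcal S)=\frac1G\sum_{w\in W}g^w\ell_{\mathcal S}(w)$ and $F_c(\mathcal S)=\max_{w\in W}\ell_{\mathcal S}(w)$. Pareto-optimality. $\mathcal{PO}^\alpha_2$ is the set of all $\mathcal S\in\mathcal N^\alpha$ for which there is no $\mathcal S'\in\mathcal N^\alpha$ with $F_m(\mathcal S')\le F_m(\mathcal S)$ and $F_c(\mathcal S')\le F_c(\mathcal S)$, at least one of the two inequalities being strict. *)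

theory Defs
  imports "HOL-Analysis.Analysis" "Graph_Theory.Shortest_Path" "Graph_Theory.Pair_Digraph"
begin

text \<open>Undirected edges are two-element sets of nodes; O/D pairs and arcs are ordered pairs.\<close>

record 'a network =
  nodes :: "'a set"
  edges :: "'a set set"
  node_cost :: "'a \<Rightarrow> real"
  edge_cost :: "'a set \<Rightarrow> real"
  arc_length :: "'a \<times> 'a \<Rightarrow> real"
  od_pairs :: "('a \<times> 'a) set"
  demand :: "'a \<times> 'a \<Rightarrow> real"
  utility :: "'a \<times> 'a \<Rightarrow> real"

type_synonym 'a subnet = "'a set \<times> 'a set set"

definition arcs_of :: "'a set set \<Rightarrow> ('a \<times> 'a) set" where
  "arcs_of E = {(i, j). {i, j} \<in> E}"

definition bidirected :: "'a subnet \<Rightarrow> ('a, 'a \<times> 'a) pre_digraph" where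
  "bidirected S = with_proj \<lparr> pverts = fst S, parcs = arcs_of (snd S) \<rparr>"

definition network_instance :: "'a network \<Rightarrow> bool" where
  "network_instance I \<longleftrightarrow>
     finite (nodes I) \<and>
     (\<forall>e\<in>edges I. e \<subseteq> nodes I \<and> card e = 2) \<and>
     (\<forall>i\<in>nodes I. node_cost I i \<ge> 0) \<and>
     (\<forall>e\<in>edges I. edge_cost I e \<ge> 0) \<and>
     (\<forall>a\<in>arcs_of (edges I). arc_length I a \<ge> 0) \<and>
     od_pairs I \<subseteq> nodes I \<times> nodes I \<and> od_pairs I \<noteq> {} \<and>
     (\<forall>w\<in>od_pairs I. fst w \<noteq> snd w \<and> demand I w > 0 \<and> utility I w > 0)"

text \<open>The library's directed cycles include going along an edge and straight back, which is a
  directed cycle of two arcs; as the graph is simple, the cycles of the undirected graph are those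
  with at least three arcs.\<close>

definition contains_cycle :: "'a network \<Rightarrow> bool" where
  "contains_cycle I \<longleftrightarrow>
     (\<exists>p. pre_digraph.cycle (bidirected (nodes I, edges I)) p \<and> length p \<ge> 3)"

definition is_subnet :: "'a network \<Rightarrow> 'a subnet \<Rightarrow> bool" where
  "is_subnet I S \<longleftrightarrow>
     fst S \<subseteq> nodes I \<and> snd S \<subseteq> edges I \<and> (\<forall>e\<in>snd S. e \<subseteq> fst S)"

lemma wf_digraph_bidirected:
  assumes "is_subnet I S"
  shows "wf_digraph (bidirected S)"
  using assms by (auto simp: wf_digraph_def bidirected_def is_subnet_def arcs_of_def)

definition total_cost :: "'a network \<Rightarrow> 'a subnet \<Rightarrow> real" where
  "total_cost I S = (\<Sum>i\<in>fst S. node_cost I i) + (\<Sum>e\<in>snd S. edge_cost I e)"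

definition feasible :: "'a network \<Rightarrow> real \<Rightarrow> 'a subnet set" where
  "feasible I \<alpha> = {S. is_subnet I S \<and> total_cost I S \<le> \<alpha> * total_cost I (nodes I, edges I)}"

text \<open>The library's distance is the infimum over all walks (attained here by a path, since lengths
  are nonnegative and the graph is finite). It is \<open>\<infinity>\<close> if no walk exists, in particular if an end
  point is not a node of the subgraph.\<close>

definition dist_in :: "'a network \<Rightarrow> 'a subnet \<Rightarrow> 'a \<times> 'a \<Rightarrow> ereal" where
  "dist_in I S w = wf_digraph.\<mu> (bidirected S) (arc_length I) (fst w) (snd w)"

definition travel_length :: "'a network \<Rightarrow> 'a subnet \<Rightarrow> 'a \<times> 'a \<Rightarrow> real" where
  "travel_length I S w = real_of_ereal (min (dist_in I S w) (ereal (utility I w)))"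

definition total_demand :: "'a network \<Rightarrow> real" where
  "total_demand I = (\<Sum>w\<in>od_pairs I. demand I w)"

definition F_m :: "'a network \<Rightarrow> 'a subnet \<Rightarrow> real" where
  "F_m I S = (1 / total_demand I) * (\<Sum>w\<in>od_pairs I. demand I w * travel_length I S w)"

definition F_c :: "'a network \<Rightarrow> 'a subnet \<Rightarrow> real" where
  "F_c I S = Max (travel_length I S ` od_pairs I)"

definition H :: "'a network \<Rightarrow> real \<Rightarrow> 'a subnet \<Rightarrow> real" where
  "H I l S = l * F_c I S + (1 - l) * F_m I S"

definition pareto_optimal :: "'a network \<Rightarrow> real \<Rightarrow> 'a subnet set" where
  "pareto_optimal I \<alpha> = {S \<in> feasible I \<alpha>.
     \<not> (\<exists>S'\<in>feasible I \<alpha>. F_m I S' \<le> F_m I S \<and> F_c I S' \<le> F_c I S \<and>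
          (F_m I S' < F_m I S \<or> F_c I S' < F_c I S))}"

definition cent_dian :: "'a network \<Rightarrow> real \<Rightarrow> real \<Rightarrow> 'a subnet \<Rightarrow> bool" where
  "cent_dian I \<alpha> l S \<longleftrightarrow> is_arg_min (H I l) (\<lambda>S'. S' \<in> feasible I \<alpha>) S"

end

theory Submission
  imports Defs
begin

text \<open>
  A convex combination of two objectives is minimized only at points on the lower-left boundary
  of the convex hull of the attainable value pairs, whereas a Pareto-optimal point may lie strictly
  above that boundary. The finitely many subgraphs of a triangle already produce such a point.

  All arcs of the triangle have length 4, and a budget of two thirds of the total cost pays for any
  two of the three equally expensive edges. Every edge carries one O/D pair, whose private utility
  8, 7 or 6 lies between one and two arc lengths. A detour over the other two edges is therefore
  never better than the private mode, so that a pair has travel length 4 if its own edge is built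
  and its utility otherwise (\<open>travel_length_equal_arcs\<close>).

  \<open>F_c\<close> is then the largest utility of an edge left out, and a network with exactly two edges has
  \<open>F_c\<close> equal to 6, 7 or 8. The demands 1, 3 and 5 give these three networks the values 46/9, 45/9
  and 40/9 of \<open>F_m\<close>. Every affordable network has its edges among those of one of the three and is
  no better than it in either objective. Hence the middle network, with value pair
  \<open>(F_c, F_m) = (7, 45/9)\<close>, is Pareto-optimal. The midpoint of the two outer value pairs, however,
  is \<open>(7, 43/9)\<close>, which is better in \<open>F_m\<close>; so for every \<open>l < 1\<close> one of the outer networks has
  a smaller \<open>H\<close>, and for \<open>l = 1\<close> the network with \<open>F_c = 6\<close> does.
\<close>

section \<open>Networks with equal arc lengths\<close>

text \<open>The cost of a walk is \<open>c\<close> times its number of arcs, and a walk between distinct nodes that are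
  not joined by an edge has at least two arcs.\<close>

lemma travel_length_equal_arcs:
  fixes I :: "'a network"
  assumes sub: "is_subnet I S"
    and len: "\<And>a. a \<in> arcs_of (edges I) \<Longrightarrow> arc_length I a = c"
    and "0 \<le> c" and "u \<noteq> v"
    and util: "c \<le> utility I (u, v)" "utility I (u, v) \<le> 2 * c"
  shows "travel_length I S (u, v) = (if {u, v} \<in> snd S then c else utility I (u, v))"
proof -
  interpret wf_digraph "bidirected S"
    using sub by (rule wf_digraph_bidirected)
  have arcs_S: "arcs (bidirected S) = arcs_of (snd S)"
    and ends: "tail (bidirected S) = fst" "head (bidirected S) = snd"
    by (simp_all add: bidirected_def)
  have "arcs_of (snd S) \<subseteq> arcs_of (edges I)"
    using sub by (auto simp: is_subnet_def arcs_of_def)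
  then have cost: "awalk_cost (arc_length I) p = c * length p"
    if "set p \<subseteq> arcs (bidirected S)" for p
    using that by (induction p) (auto simp: arcs_S len algebra_simps)
  have lower: "ereal (c * k) \<le> dist_in I S (u, v)"
    if "\<And>p. awalk u p v \<Longrightarrow> k \<le> length p" for k :: nat
    unfolding dist_in_def \<mu>_def
  proof (rule INF_greatest)
    fix p assume "p \<in> {p. awalk (fst (u, v)) p (snd (u, v))}"
    then have p: "awalk u p v" by simp
    then have "awalk_cost (arc_length I) p = c * length p"
      by (intro cost) (auto simp: awalk_def)
    then show "ereal (c * k) \<le> ereal (awalk_cost (arc_length I) p)"
      using that[OF p] \<open>0 \<le> c\<close> by (simp add: mult_left_mono)
  qed
  show ?thesis
  proof (cases "{u, v} \<in> snd S")
    case True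
    then have arc: "(u, v) \<in> arcs (bidirected S)"
      by (simp add: arcs_S arcs_of_def)
    have "awalk u [(u, v)] v"
      using arc_implies_awalk[OF arc] by (simp add: ends)
    then have "dist_in I S (u, v) \<le> ereal c"
      using min_cost_le_walk_cost[of u "[(u, v)]" v "arc_length I"] cost[of "[(u, v)]"] arc
      by (simp add: dist_in_def)
    moreover have "1 \<le> length p" if "awalk u p v" for p
      using that \<open>u \<noteq> v\<close> by (cases p) (auto simp: awalk_def)
    then have "ereal c \<le> dist_in I S (u, v)"
      using lower[of 1] by simp
    ultimately have "dist_in I S (u, v) = ereal c" by (rule antisym)
    then show ?thesis
      using True util by (simp add: travel_length_def)
  next
    case False
    have "2 \<le> length p" if p: "awalk u p v" for p
    proof (rule ccontr)
      assume "\<not> 2 \<le> length p"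
      then consider "p = []" | a where "p = [a]"
        by (cases p; cases "tl p") auto
      then show False
        using p False \<open>u \<noteq> v\<close> by cases (auto simp: awalk_def arcs_S ends arcs_of_def)
    qed
    then have "ereal (c * 2) \<le> dist_in I S (u, v)"
      using lower[of 2] by simp
    then have "ereal (utility I (u, v)) \<le> dist_in I S (u, v)"
      using util(2) by (intro order_trans[OF _ \<open>ereal (c * 2) \<le> _\<close>]) simp
    then show ?thesis
      using False by (simp add: travel_length_def min_absorb2)
  qed
qed

section \<open>The triangle\<close>

definition triangle :: "nat network" where
  "triangle =
    \<lparr> nodes = {0, 1, 2},
      edges = {{0, 1}, {1, 2}, {0, 2}},
      node_cost = (\<lambda>_. 0),
      edge_cost = (\<lambda>_. 1),
      arc_length = (\<lambda>_. 4),
      od_pairs = {(0, 1), (1, 2), (0, 2)},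
      demand = (\<lambda>w. if w = (0, 1) then 1 else if w = (1, 2) then 3 else 5),
      utility = (\<lambda>w. if w = (0, 1) then 8 else if w = (1, 2) then 7 else 6) \<rparr>"

lemma triangle_edges_distinct:
  "{0, 1} \<noteq> {1, 2 :: nat}" "{0, 1} \<noteq> {0, 2 :: nat}" "{1, 2} \<noteq> {0, 2 :: nat}"
  by (auto simp: doubleton_eq_iff)

lemma network_instance_triangle: "network_instance triangle"
  by (auto simp: network_instance_def triangle_def)

lemma contains_cycle_triangle: "contains_cycle triangle"
proof -
  let ?G = "bidirected (nodes triangle, edges triangle)"
  have "{2, 0 :: nat} = {0, 2}" by auto
  then have "pre_digraph.cycle ?G [(0, 1), (1, 2), (2, 0)]"
    unfolding pre_digraph.cycle_def pre_digraph.awalk_def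
    by (intro exI[of _ 0])
      (simp add: bidirected_def cas_with_proj_eq awalk_verts_with_proj_eq triangle_def arcs_of_def)
  then show ?thesis
    unfolding contains_cycle_def by (intro exI conjI) auto
qed

text \<open>Two of the three edges are affordable, all three are not.\<close>

lemma feasible_triangle:
  "S \<in> feasible triangle (2/3) \<longleftrightarrow> is_subnet triangle S \<and> snd S \<noteq> edges triangle"
proof -
  let ?E = "edges triangle"
  have fin: "finite ?E" and card: "card ?E = 3"
    using triangle_edges_distinct by (simp_all add: triangle_def)
  have cost: "total_cost triangle S = card (snd S)" for S
    by (simp add: total_cost_def triangle_def)
  have "card (snd S) \<le> 2 \<longleftrightarrow> snd S \<noteq> ?E" if "is_subnet triangle S"
  proof -
    have sub: "snd S \<subseteq> ?E" using that by (simp add: is_subnet_def)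
    have "card (snd S) < 3" if "snd S \<noteq> ?E"
      using psubset_card_mono[OF fin] sub that card by (simp add: psubset_eq)
    then show ?thesis using card by fastforce
  qed
  then show ?thesis by (auto simp: feasible_def cost card)
qed

lemma travel_length_triangle:
  assumes "is_subnet triangle S"
  shows "travel_length triangle S (0, 1) = (if {0, 1} \<in> snd S then 4 else 8)"
    and "travel_length triangle S (1, 2) = (if {1, 2} \<in> snd S then 4 else 7)"
    and "travel_length triangle S (0, 2) = (if {0, 2} \<in> snd S then 4 else 6)"
  by (subst travel_length_equal_arcs[OF assms, of 4]; simp add: triangle_def)+

lemma F_m_triangle:
  assumes "is_subnet triangle S"
  shows "F_m triangle S = (1 * (if {0, 1} \<in> snd S then 4 else 8)
    + 3 * (if {1, 2} \<in> snd S then 4 else 7) + 5 * (if {0, 2} \<in> snd S then 4 else 6)) / 9"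
proof -
  have od: "od_pairs triangle = {(0, 1), (1, 2), (0, 2)}"
    and dem: "demand triangle (0, 1) = 1" "demand triangle (1, 2) = 3" "demand triangle (0, 2) = 5"
    by (simp_all add: triangle_def)
  show ?thesis
    unfolding F_m_def total_demand_def od
    using dem travel_length_triangle[OF assms] by simp
qed

lemma F_c_triangle:
  assumes "is_subnet triangle S"
  shows "F_c triangle S = max (if {0, 1} \<in> snd S then 4 else 8)
    (max (if {1, 2} \<in> snd S then 4 else 7) (if {0, 2} \<in> snd S then 4 else 6))"
proof -
  have od: "od_pairs triangle = {(0, 1), (1, 2), (0, 2)}"
    by (simp add: triangle_def)
  show ?thesis
    unfolding F_c_def od using travel_length_triangle[OF assms] by simp
qed

lemma is_subnet_triangle: "E \<subseteq> edges triangle \<Longrightarrow> is_subnet triangle ({0, 1, 2}, E)"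
  by (auto simp: is_subnet_def triangle_def)

section \<open>A Pareto-optimal network that is not a cent-dian\<close>

theorem mainTheorem7:
  shows "\<exists>(I :: nat network) (\<alpha> :: real) S\<^sub>1.
           network_instance I \<and> contains_cycle I \<and> 0 \<le> \<alpha> \<and> \<alpha> \<le> 1 \<and>
           S\<^sub>1 \<in> pareto_optimal I \<alpha> \<and>
           \<not> (\<exists>l::real. 0 \<le> l \<and> l \<le> 1 \<and> cent_dian I \<alpha> l S\<^sub>1)"
proof -
  define N where "N = {0, 1, 2 :: nat}"
  define S6 S7 S8 :: "nat subnet" where "S6 = (N, {{0, 1}, {1, 2}})" and "S7 = (N, {{0, 1}, {0, 2}})"
    and "S8 = (N, {{1, 2}, {0, 2}})"
  note defs = S6_def S7_def S8_def
  have sub: "is_subnet triangle S6" "is_subnet triangle S7" "is_subnet triangle S8"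
    unfolding defs N_def by (rule is_subnet_triangle; simp add: triangle_def)+
  have E: "edges triangle = {{0, 1}, {1, 2}, {0, 2}}"
    by (simp add: triangle_def)
  have mem6: "{0, 1} \<in> snd S6" "{1, 2} \<in> snd S6" "{0, 2} \<notin> snd S6"
    and mem7: "{0, 1} \<in> snd S7" "{1, 2} \<notin> snd S7" "{0, 2} \<in> snd S7"
    and mem8: "{0, 1} \<notin> snd S8" "{1, 2} \<in> snd S8" "{0, 2} \<in> snd S8"
    using triangle_edges_distinct by (simp_all add: defs)
  have feas: "S6 \<in> feasible triangle (2/3)" "S7 \<in> feasible triangle (2/3)"
    "S8 \<in> feasible triangle (2/3)"
    using sub mem6 mem7 mem8 E unfolding feasible_triangle by blast+
  have val6: "F_c triangle S6 = 6" "F_m triangle S6 = 46 / 9"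
    and val7: "F_c triangle S7 = 7" "F_m triangle S7 = 45 / 9"
    and val8: "F_c triangle S8 = 8" "F_m triangle S8 = 40 / 9"
    using F_c_triangle[OF sub(1)] F_m_triangle[OF sub(1)] F_c_triangle[OF sub(2)]
      F_m_triangle[OF sub(2)] F_c_triangle[OF sub(3)] F_m_triangle[OF sub(3)] mem6 mem7 mem8
    by simp_all
  have "\<not> (F_m triangle S \<le> F_m triangle S7 \<and> F_c triangle S \<le> F_c triangle S7 \<and>
      (F_m triangle S < F_m triangle S7 \<or> F_c triangle S < F_c triangle S7))"
    if S: "S \<in> feasible triangle (2/3)" for S
  proof -
    have sub_S: "is_subnet triangle S" and "snd S \<noteq> edges triangle"
      using S by (simp_all add: feasible_triangle)
    then have "\<not> ({0, 1} \<in> snd S \<and> {1, 2} \<in> snd S \<and> {0, 2} \<in> snd S)"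
      by (auto simp: is_subnet_def E)
    then show ?thesis
      unfolding val7 F_c_triangle[OF sub_S] F_m_triangle[OF sub_S] by (simp split: if_splits)
  qed
  then have pareto: "S7 \<in> pareto_optimal triangle (2/3)"
    using feas(2) unfolding pareto_optimal_def by blast
  have not_cent_dian: "\<not> cent_dian triangle (2/3) l S7" if "0 \<le> l" "l \<le> 1" for l
  proof
    assume "cent_dian triangle (2/3) l S7"
    then have "H triangle l S7 \<le> H triangle l S" if "S \<in> feasible triangle (2/3)" for S
      using that unfolding cent_dian_def is_arg_min_def by (meson not_less)
    from this[OF feas(1)] this[OF feas(3)]
    have "l \<le> (1 - l) / 9" "5 * (1 - l) / 9 \<le> l"
      unfolding H_def val6 val7 val8 by (simp_all add: field_simps)
    \<comment> \<open>The two bounds together give \<open>5 * (1 - l) \<le> 1 - l\<close>, so \<open>l = 1\<close>, against the first.\<close>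
    then show False using \<open>l \<le> 1\<close> by simp
  qed
  show ?thesis
    by (rule exI[of _ triangle], rule exI[of _ "2/3"], rule exI[of _ S7])
      (use network_instance_triangle contains_cycle_triangle pareto not_cent_dian in auto)
qed

end
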